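(* Let $(Z,\Phi)$ be a topological flow on a compact metrizable space that is an extension of the solenoid $(Y,\Psi)$. Then $(Z,\Phi)$ is topologically conjugate to a suspension flow under a constant function; that is, there exist a compact metrizable space $W$, a homeomorphism $T:W\to W$ and a constant function $f:W\to(0,\infty)$ such that $(Z,\Phi)$ is topologically conjugate to the suspension flow $(W_f,T_f)$.
   Context: A topological flow $(X,\Phi)$ is a compact space $X$ with a continuous action $\Phi=(\Phi_t)_{t\in\mathbb{R}}$ of the group $\mathbb{R}$. $(Z,\Phi)$ is an extension of $(Y,\Psi)$ if there is a continuous surjection $\pi:Z\to Y$ with $\pi\circ\Phi_t=\Psi_t\circ\pi$ for all $t\in\mathbb{R}$. Two flows are topologically conjugate if there is an $\mathbb{R}$-equivariant homeomorphism between them. Solenoid: for $n\ge 1$ let $Y_n=[0,n!]$ with $0$ identified with $n!$ (i.e. the circle $\mathbb{R}/n!\mathbb{Z}$). Let $Y=\{(x_n)_{n\ge1}\in\prod_{n\ge1}Y_n : x_n = x_{n+1} \bmod n!\ \text{for all } n\}$, with flow $\Psi_r((x_n)_n)=(x_n+r \bmod n!)_n$, $r\in\mathbb{R}$. The flow $(Y,\Psi)$ is the solenoid. Suspension flow: for a compact metric space $W$, a homeomorphism $T:W\to W$ and a continuous $f:W\to(0,\infty)$, let $W_f=\{(x,t):x\in W,\ 0\le t\le f(x)\}/\big((x,f(x))\sim(Tx,0)\big)$; the suspension flow $(W_f,T_f)$ is the flow on $W_f$ induced by the time translation $(x,s)\mapsto(x,s+t)$, $t\in\mathbb{R}$. 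*)

theory Defs
  imports "HOL-Analysis.Analysis"
begin

section \<open>Topological flows\<close>

definition topological_flow :: "'a topology \<Rightarrow> (real \<Rightarrow> 'a \<Rightarrow> 'a) \<Rightarrow> bool" where
  "topological_flow X \<Phi> \<longleftrightarrow>
     compact_space X \<and>
     continuous_map (prod_topology euclideanreal X) X (\<lambda>(t, x). \<Phi> t x) \<and>
     (\<forall>x\<in>topspace X. \<Phi> 0 x = x) \<and>
     (\<forall>s t. \<forall>x\<in>topspace X. \<Phi> (s + t) x = \<Phi> s (\<Phi> t x))"

definition flow_extension ::
  "'a topology \<Rightarrow> (real \<Rightarrow> 'a \<Rightarrow> 'a) \<Rightarrow> 'b topology \<Rightarrow> (real \<Rightarrow> 'b \<Rightarrow> 'b) \<Rightarrow> bool" where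
  "flow_extension Z \<Phi> Y \<Psi> \<longleftrightarrow>
     (\<exists>p. continuous_map Z Y p \<and> p ` topspace Z = topspace Y \<and>
          (\<forall>t. \<forall>z\<in>topspace Z. p (\<Phi> t z) = \<Psi> t (p z)))"

definition flow_conjugate ::
  "'a topology \<Rightarrow> (real \<Rightarrow> 'a \<Rightarrow> 'a) \<Rightarrow> 'b topology \<Rightarrow> (real \<Rightarrow> 'b \<Rightarrow> 'b) \<Rightarrow> bool" where
  "flow_conjugate X \<Phi> Y \<Psi> \<longleftrightarrow>
     (\<exists>h. homeomorphic_map X Y h \<and>
          (\<forall>t. \<forall>x\<in>topspace X. h (\<Phi> t x) = \<Psi> t (h x)))"


section \<open>Quotient spaces\<close>

text \<open>The points of the quotient are the classes \<open>Collect (r x)\<close>; \<open>r\<close> is meant to be an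
  equivalence relation under which \<open>topspace X\<close> is closed.\<close>

definition quotient_topology :: "'a topology \<Rightarrow> ('a \<Rightarrow> 'a \<Rightarrow> bool) \<Rightarrow> 'a set topology" where
  "quotient_topology X r = topology (\<lambda>U.
     U \<subseteq> (\<lambda>x. Collect (r x)) ` topspace X \<and>
     openin X {x \<in> topspace X. Collect (r x) \<in> U})"

lemma openin_quotient_topology:
  "openin (quotient_topology X r) U \<longleftrightarrow>
     U \<subseteq> (\<lambda>x. Collect (r x)) ` topspace X \<and>
     openin X {x \<in> topspace X. Collect (r x) \<in> U}"
proof -
  let ?c = "\<lambda>x. Collect (r x)"
  let ?P = "\<lambda>U. U \<subseteq> ?c ` topspace X \<and> openin X {x \<in> topspace X. ?c x \<in> U}"
  have "?P (S \<inter> T)" if "?P S" "?P T" for S T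
  proof -
    have "{x \<in> topspace X. ?c x \<in> S \<inter> T}
        = {x \<in> topspace X. ?c x \<in> S} \<inter> {x \<in> topspace X. ?c x \<in> T}" by auto
    then show ?thesis using that by (auto intro: openin_Int)
  qed
  moreover have "?P (\<Union>\<K>)" if "\<forall>K\<in>\<K>. ?P K" for \<K>
  proof -
    have "{x \<in> topspace X. ?c x \<in> \<Union>\<K>} = (\<Union>K\<in>\<K>. {x \<in> topspace X. ?c x \<in> K})" by auto
    moreover have "openin X (\<Union>K\<in>\<K>. {x \<in> topspace X. ?c x \<in> K})"
      using that by (intro openin_Union) auto
    ultimately show ?thesis using that by auto
  qed
  ultimately have "istopology ?P"
    unfolding istopology_def by blast
  then show ?thesis
    by (simp add: quotient_topology_def topology_inverse')
qed

lemma topspace_quotient_topology: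
  "topspace (quotient_topology X r) = (\<lambda>x. Collect (r x)) ` topspace X"
proof (rule antisym)
  show "topspace (quotient_topology X r) \<subseteq> (\<lambda>x. Collect (r x)) ` topspace X"
    using openin_topspace openin_quotient_topology by metis
  have "openin (quotient_topology X r) ((\<lambda>x. Collect (r x)) ` topspace X)"
    by (simp add: openin_quotient_topology Collect_conj_eq Int_absorb2 subset_iff)
  then show "(\<lambda>x. Collect (r x)) ` topspace X \<subseteq> topspace (quotient_topology X r)"
    by (rule openin_subset)
qed

lemma quotient_map_quotient_topology:
  "quotient_map X (quotient_topology X r) (\<lambda>x. Collect (r x))"
  unfolding quotient_map_def topspace_quotient_topology openin_quotient_topology by auto


section \<open>The solenoid\<close>

definition circle_rel :: "nat \<Rightarrow> real \<Rightarrow> real \<Rightarrow> bool" where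
  "circle_rel n a b \<longleftrightarrow> (\<exists>k::int. b = a + of_int k * fact n)"

text \<open>The circle of circumference \<open>n!\<close>, as the quotient of the real line by the
  multiples of \<open>n!\<close>.\<close>

definition circle :: "nat \<Rightarrow> real set topology" where
  "circle n = quotient_topology euclideanreal (circle_rel n)"

text \<open>Reduction modulo \<open>n!\<close>. For \<open>m \<ge> n\<close> it maps a coset of the multiples of \<open>m!\<close> to the
  coset of the multiples of \<open>n!\<close> that contains it.\<close>

definition reduce_mod :: "nat \<Rightarrow> real set \<Rightarrow> real set" where
  "reduce_mod n c = {b. \<exists>a\<in>c. circle_rel n a b}"

definition solenoid :: "(nat \<Rightarrow> real set) topology" where
  "solenoid = subtopology (product_topology circle {1..})
     {x. \<forall>n\<ge>1. x n = reduce_mod n (x (Suc n))}"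

text \<open>Points of the product are functions that are \<open>undefined\<close> at the index \<open>0\<close>, which is why
  the flow is restricted to \<open>{1..}\<close>.\<close>

definition solenoid_flow :: "real \<Rightarrow> (nat \<Rightarrow> real set) \<Rightarrow> nat \<Rightarrow> real set" where
  "solenoid_flow r x = (\<lambda>n\<in>{1..}. (\<lambda>a. a + r) ` x n)"


section \<open>Suspension flows\<close>

definition susp_region :: "'w topology \<Rightarrow> ('w \<Rightarrow> real) \<Rightarrow> ('w \<times> real) set" where
  "susp_region W f = {(x, s). x \<in> topspace W \<and> 0 \<le> s \<and> s \<le> f x}"

definition susp_glue ::
  "'w topology \<Rightarrow> ('w \<Rightarrow> 'w) \<Rightarrow> ('w \<Rightarrow> real) \<Rightarrow> 'w \<times> real \<Rightarrow> 'w \<times> real \<Rightarrow> bool" where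
  "susp_glue W T f p q \<longleftrightarrow> (\<exists>x\<in>topspace W. p = (x, f x) \<and> q = (T x, 0))"

definition susp_space ::
  "'w topology \<Rightarrow> ('w \<Rightarrow> 'w) \<Rightarrow> ('w \<Rightarrow> real) \<Rightarrow> ('w \<times> real) set topology" where
  "susp_space W T f =
     quotient_topology (subtopology (prod_topology W euclideanreal) (susp_region W f))
       (equivclp (susp_glue W T f))"

text \<open>The translation \<open>(x, s) \<mapsto> (x, s + t)\<close> in general leaves \<open>susp_region W f\<close>. The translated
  point is brought back by the identifications \<open>(x, s + f x) \<sim> (T x, s)\<close> for all real \<open>s\<close>, of
  which the gluing is the case \<open>s = 0\<close>. For \<open>f > 0\<close> and injective \<open>T\<close>, these identify no further
  points of the region (\<open>susp_shift_on_region\<close> below).\<close>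

definition susp_shift ::
  "'w topology \<Rightarrow> ('w \<Rightarrow> 'w) \<Rightarrow> ('w \<Rightarrow> real) \<Rightarrow> 'w \<times> real \<Rightarrow> 'w \<times> real \<Rightarrow> bool" where
  "susp_shift W T f p q \<longleftrightarrow> (\<exists>x\<in>topspace W. \<exists>s. p = (x, s + f x) \<and> q = (T x, s))"

definition susp_flow ::
  "'w topology \<Rightarrow> ('w \<Rightarrow> 'w) \<Rightarrow> ('w \<Rightarrow> real) \<Rightarrow> real \<Rightarrow> ('w \<times> real) set \<Rightarrow> ('w \<times> real) set" where
  "susp_flow W T f t c =
     {q \<in> susp_region W f. \<exists>(x, s)\<in>c. equivclp (susp_shift W T f) (x, s + t) q}"

lemma susp_shift_on_region:
  assumes f: "\<And>x. x \<in> topspace W \<Longrightarrow> 0 < f x" and T: "inj_on T (topspace W)"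
    and p: "p \<in> susp_region W f" and q: "q \<in> susp_region W f"
  shows "equivclp (susp_shift W T f) p q \<longleftrightarrow> equivclp (susp_glue W T f) p q"
proof
  let ?r = "susp_shift W T f" and ?g = "susp_glue W T f"
  have g_r: "?r a b" if "?g a b" for a b
    using that unfolding susp_glue_def susp_shift_def by force
  show "equivclp ?r p q" if "equivclp ?g p q"
    using that
  proof (induction rule: equivclp_induct)
    case base
    show ?case by simp
  next
    case (step y z)
    from step.hyps(2) have "?r y z \<or> ?r z y" using g_r[of y z] g_r[of z y] by blast
    with step.IH show ?case by (rule equivclp_into_equivclp)
  qed
  have det: "b = c" if "?r a b" "?r a c" for a b c
    using that unfolding susp_shift_def by auto
  have inj: "b = c" if b: "?r b a" and c: "?r c a" for a b c
  proof -
    obtain x s where x: "x \<in> topspace W" "b = (x, s + f x)" "a = (T x, s)"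
      using b unfolding susp_shift_def by blast
    obtain y u where y: "y \<in> topspace W" "c = (y, u + f y)" "a = (T y, u)"
      using c unfolding susp_shift_def by blast
    have "T x = T y" "s = u" using x(3) y(3) by auto
    moreover from this have "x = y" using inj_onD[OF T] x(1) y(1) by blast
    ultimately show ?thesis using x(2) y(2) by simp
  qed
  have dec: "snd b < snd a" if "?r a b" for a b
    using that f unfolding susp_shift_def by auto
  have dec': "b = a \<or> snd b < snd a" if "?r\<^sup>*\<^sup>* a b" for a b
    using that by (induction rule: rtranclp_induct) (auto dest: dec)
  have glue: "equivclp ?g a b" if ab: "?r\<^sup>*\<^sup>* a b"
    and a: "a \<in> susp_region W f" and b: "b \<in> susp_region W f" for a b
    using ab
  proof (cases rule: converse_rtranclpE)
    case base
    then show ?thesis by simp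
  next
    case (step c)
    obtain x s where x: "x \<in> topspace W" "a = (x, s + f x)" "c = (T x, s)"
      using step(1) unfolding susp_shift_def by blast
    have "s \<le> 0" using a x unfolding susp_region_def by auto
    moreover have "0 \<le> snd b" using b unfolding susp_region_def by auto
    ultimately have "b = c" "s = 0" using dec'[OF step(2)] x by auto
    then have "?g a b" using x unfolding susp_glue_def by auto
    then show ?thesis by blast
  qed
  show "equivclp ?g p q" if "equivclp ?r p q"
  proof -
    have "?r\<^sup>*\<^sup>* p q \<or> ?r\<^sup>*\<^sup>* q p"
      using that
    proof (induction rule: equivclp_induct)
      case base
      show ?case by simp
    next
      case (step y z)
      from step.hyps(2) show ?case
      proof
        assume yz: "?r y z"
        from step.IH show ?thesis
        proof
          assume "?r\<^sup>*\<^sup>* p y"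
          then have "?r\<^sup>*\<^sup>* p z" using yz by (rule rtranclp.rtrancl_into_rtrancl)
          then show ?thesis ..
        next
          assume "?r\<^sup>*\<^sup>* y p"
          then have "y = p \<or> (\<exists>w. ?r y w \<and> ?r\<^sup>*\<^sup>* w p)"
            by (rule converse_rtranclpE) auto
          then show ?thesis using det[OF yz] yz by blast
        qed
      next
        assume zy: "?r z y"
        from step.IH show ?thesis
        proof
          assume "?r\<^sup>*\<^sup>* p y"
          then have "y = p \<or> (\<exists>w. ?r\<^sup>*\<^sup>* p w \<and> ?r w y)"
            by (rule rtranclp.cases) auto
          then show ?thesis using inj[OF zy] zy by blast
        next
          assume "?r\<^sup>*\<^sup>* y p"
          with zy have "?r\<^sup>*\<^sup>* z p" by (rule converse_rtranclp_into_rtranclp)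
          then show ?thesis ..
        qed
      qed
    qed
    then show ?thesis
    proof
      assume "?r\<^sup>*\<^sup>* p q"
      then show ?thesis using glue p q by simp
    next
      assume "?r\<^sup>*\<^sup>* q p"
      then have "equivclp ?g q p" using glue p q by simp
      then show ?thesis by (rule equivclp_sym)
    qed
  qed
qed

lemma equivclp_susp_glue_region:
  assumes "\<And>x. x \<in> topspace W \<Longrightarrow> 0 < f x" and "T ` topspace W \<subseteq> topspace W"
    and "p \<in> susp_region W f" and "equivclp (susp_glue W T f) p q"
  shows "q \<in> susp_region W f"
  using assms(4,3)
proof (induction rule: equivclp_induct)
  case base
  then show ?case .
next
  case (step y z)
  have "a \<in> susp_region W f \<and> b \<in> susp_region W f" if ab: "susp_glue W T f a b" for a b
  proof -
    obtain x where "x \<in> topspace W" "a = (x, f x)" "b = (T x, 0)"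
      using ab unfolding susp_glue_def by blast
    moreover from this have "T x \<in> topspace W" using assms(2) by blast
    ultimately show ?thesis
      using assms(1)[of x] assms(1)[of "T x"] unfolding susp_region_def by simp
  qed
  with step.hyps(2) show ?case by blast
qed

text \<open>As long as it stays in the region, a point moves by translation of its second
  coordinate.\<close>

lemma susp_flow_local:
  assumes f: "\<And>x. x \<in> topspace W \<Longrightarrow> 0 < f x"
    and T: "inj_on T (topspace W)" "T ` topspace W \<subseteq> topspace W"
    and p: "(x, s) \<in> susp_region W f" and q: "(x, s + t) \<in> susp_region W f"
  shows "susp_flow W T f t (Collect (equivclp (susp_glue W T f) (x, s))) =
    Collect (equivclp (susp_glue W T f) (x, s + t))"
proof -
  let ?r = "susp_shift W T f" and ?g = "susp_glue W T f"
  have tr: "equivclp ?r (fst a, snd a + t) (fst b, snd b + t)" if "equivclp ?r a b" for a b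
    using that
  proof (induction rule: equivclp_induct)
    case base
    show ?case by simp
  next
    case (step y z)
    have "?r (fst u, snd u + t) (fst v, snd v + t)" if "?r u v" for u v
      using that unfolding susp_shift_def by force
    with step.hyps(2) have "?r (fst y, snd y + t) (fst z, snd z + t) \<or>
        ?r (fst z, snd z + t) (fst y, snd y + t)" by blast
    with step.IH show ?case by (rule equivclp_into_equivclp)
  qed
  show ?thesis
  proof (intro set_eqI iffI)
    fix u assume "u \<in> susp_flow W T f t (Collect (equivclp ?g (x, s)))"
    then obtain y v where u: "u \<in> susp_region W f" and yv: "equivclp ?g (x, s) (y, v)"
      and yu: "equivclp ?r (y, v + t) u"
      unfolding susp_flow_def by auto
    have "(y, v) \<in> susp_region W f"
      using equivclp_susp_glue_region[OF f T(2) p yv] .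
    then have "equivclp ?r (x, s) (y, v)"
      using susp_shift_on_region[OF f T(1) p] yv by blast
    then have "equivclp ?r (x, s + t) u"
      using tr yu by (metis equivclp_trans fst_conv snd_conv)
    then show "u \<in> Collect (equivclp ?g (x, s + t))"
      using susp_shift_on_region[OF f T(1) q u] by simp
  next
    fix u assume "u \<in> Collect (equivclp ?g (x, s + t))"
    then have gu: "equivclp ?g (x, s + t) u" by simp
    have u: "u \<in> susp_region W f"
      using equivclp_susp_glue_region[OF f T(2) q gu] .
    have "equivclp ?r (x, s + t) u"
      using susp_shift_on_region[OF f T(1) q u] gu by simp
    then show "u \<in> susp_flow W T f t (Collect (equivclp ?g (x, s)))"
      unfolding susp_flow_def using u by (intro CollectI conjI bexI[of _ "(x, s)"]) simp_all
  qed
qed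

end

theory Submission
  imports Defs
begin

text \<open>The first coordinate of a point of the solenoid is a coset of the integers, so an extension
  \<open>Z\<close> of the solenoid comes with an equivariant continuous map \<open>q\<close> to the circle of length one, on
  which the flow is rotation at unit speed. The points that \<open>q\<close> sends to the coset of \<open>0\<close> form a
  closed set which every orbit meets, and which a point of it visits exactly at integer times.

  Such a set is a global cross section with constant return time, and this suffices
  (\<open>conjugate_suspension\<close>): for a closed section \<open>S\<close> with return times the multiples of \<open>c\<close>, the
  map \<open>(x, s) \<mapsto> \<Phi> s x\<close> from \<open>S \<times> [0, c]\<close> onto \<open>Z\<close> identifies precisely the points that the
  suspension of \<open>\<Phi> c\<close> under the constant \<open>c\<close> identifies (\<open>equivclp_susp_shift_iff\<close>). As a
  continuous surjection from a compact space to a Hausdorff space it is a quotient map, so \<open>Z\<close> is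
  the suspension space. The other circles in the solenoid would give the conjugacies with
  suspensions under the constants \<open>n!\<close>.\<close>


section \<open>Closed cross sections with constant return time\<close>

locale constant_return_section =
  fixes Z :: "'z topology" and \<Phi> :: "real \<Rightarrow> 'z \<Rightarrow> 'z" and S :: "'z set" and c :: real
  assumes flow: "topological_flow Z \<Phi>"
    and Hausdorff: "Hausdorff_space Z"
    and closed: "closedin Z S"
    and c_pos: "0 < c"
    and return_times: "\<And>x t. x \<in> S \<Longrightarrow> \<Phi> t x \<in> S \<longleftrightarrow> (\<exists>k::int. t = of_int k * c)"
    and meets_orbits: "\<And>z. z \<in> topspace Z \<Longrightarrow> \<exists>t. \<Phi> t z \<in> S"
begin

abbreviation W :: "'z topology" where "W \<equiv> subtopology Z S"

abbreviation shift :: "'z \<times> real \<Rightarrow> 'z \<times> real \<Rightarrow> bool" where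
  "shift \<equiv> susp_shift W (\<Phi> c) (\<lambda>_. c)"

abbreviation glue :: "'z \<times> real \<Rightarrow> 'z \<times> real \<Rightarrow> bool" where
  "glue \<equiv> susp_glue W (\<Phi> c) (\<lambda>_. c)"

abbreviation region :: "('z \<times> real) set" where
  "region \<equiv> susp_region W (\<lambda>_. c)"

lemma S_subset: "S \<subseteq> topspace Z"
  using closed by (rule closedin_subset)

lemma S_in_space [simp]: "x \<in> S \<Longrightarrow> x \<in> topspace Z"
  using S_subset by blast

lemma topspace_W [simp]: "topspace W = S"
  using S_subset by auto

lemma continuous_flow: "continuous_map (prod_topology euclideanreal Z) Z (\<lambda>(t, x). \<Phi> t x)"
  using flow by (simp add: topological_flow_def)

lemma flow_0: "x \<in> topspace Z \<Longrightarrow> \<Phi> 0 x = x"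
  using flow by (simp add: topological_flow_def)

lemma flow_add: "x \<in> topspace Z \<Longrightarrow> \<Phi> (s + t) x = \<Phi> s (\<Phi> t x)"
  using flow by (simp add: topological_flow_def)

lemma flow_in_space: "x \<in> topspace Z \<Longrightarrow> \<Phi> t x \<in> topspace Z"
  using continuous_map_funspace[OF continuous_flow] by (auto simp: Pi_iff)

lemma continuous_time_map: "continuous_map Z Z (\<Phi> t)"
proof -
  have "continuous_map Z (prod_topology euclideanreal Z) (\<lambda>x. (t, x))"
    by (simp add: continuous_map_pairedI)
  from continuous_map_compose[OF this continuous_flow] show ?thesis
    by (simp add: o_def)
qed

lemma flow_uminus: "x \<in> topspace Z \<Longrightarrow> \<Phi> (- t) (\<Phi> t x) = x"
  using flow_add[of x "- t" t] by (simp add: flow_0)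

lemma flow_multiple_in_S: "x \<in> S \<Longrightarrow> \<Phi> (of_int k * c) x \<in> S"
  using return_times by blast

lemma flow_period_in_S: "x \<in> S \<Longrightarrow> \<Phi> c x \<in> S" "x \<in> S \<Longrightarrow> \<Phi> (- c) x \<in> S"
  using flow_multiple_in_S[of x 1] flow_multiple_in_S[of x "- 1"] by simp_all

lemma homeomorphic_return_map: "homeomorphic_map W W (\<Phi> c)"
proof (rule homeomorphic_maps_imp_map)
  have "continuous_map W W (\<Phi> t)" if "\<And>x. x \<in> S \<Longrightarrow> \<Phi> t x \<in> S" for t
    using that continuous_time_map
    by (auto simp: continuous_map_in_subtopology continuous_map_from_subtopology)
  moreover have "\<Phi> (- c) (\<Phi> c x) = x \<and> \<Phi> c (\<Phi> (- c) x) = x" if "x \<in> S" for x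
    using that S_subset flow_uminus[of x c] flow_uminus[of x "- c"] by auto
  ultimately show "homeomorphic_maps W W (\<Phi> c) (\<Phi> (- c))"
    unfolding homeomorphic_maps_def using flow_period_in_S by auto
qed

lemma inj_on_return_map: "inj_on (\<Phi> c) (topspace W)"
  using homeomorphic_return_map by (rule homeomorphic_imp_injective_map)

lemma equivclp_shift_multiple:
  assumes "x \<in> S"
  shows "equivclp shift (x, s + of_int k * c) (\<Phi> (of_int k * c) x, s)"
proof -
  have up: "equivclp shift (x, s + of_nat n * c) (\<Phi> (of_nat n * c) x, s)"
    if "x \<in> S" for n x s
    using that
  proof (induction n arbitrary: s)
    case 0
    then show ?case using S_subset flow_0 by auto
  next
    case (Suc n)
    let ?y = "\<Phi> (of_nat n * c) x"
    have "?y \<in> S" using flow_multiple_in_S[of x "int n"] Suc.prems by simp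
    then have "shift (?y, s + c) (\<Phi> c ?y, s)"
      unfolding susp_shift_def by auto
    moreover have "\<Phi> c ?y = \<Phi> (of_nat (Suc n) * c) x"
      using flow_add[of x c "of_nat n * c"] Suc.prems by (simp add: algebra_simps)
    moreover have "equivclp shift (x, (s + c) + of_nat n * c) (?y, s + c)"
      using Suc.IH Suc.prems by blast
    ultimately show ?case
      using equivclp_into_equivclp[of shift "(x, (s + c) + of_nat n * c)" "(?y, s + c)"]
      by (simp add: algebra_simps)
  qed
  show ?thesis
  proof (cases "0 \<le> k")
    case True
    then show ?thesis using up[OF assms, of s "nat k"] by simp
  next
    case False
    define y where "y = \<Phi> (of_int k * c) x"
    have "y \<in> S" unfolding y_def using assms by (rule flow_multiple_in_S)
    \<comment> \<open>Start from \<open>y\<close>, from which \<open>x\<close> is reached after a nonnegative number of periods.\<close>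
    from up[OF this, of "s + of_int k * c" "nat (- k)"]
    have "equivclp shift (y, s) (\<Phi> (- (of_int k * c)) y, s + of_int k * c)"
      using False by simp
    moreover have "\<Phi> (- (of_int k * c)) y = x"
      unfolding y_def using flow_uminus assms S_subset by blast
    ultimately show ?thesis unfolding y_def by (metis equivclp_sym)
  qed
qed

text \<open>The identifications of the suspension leave \<open>\<Phi> u a\<close> unchanged. Conversely, if \<open>(a, u)\<close>
  and \<open>(b, v)\<close> give the same point of \<open>Z\<close>, then \<open>b = \<Phi> (u - v) a\<close>, and since both ends lie in
  the section, \<open>u - v\<close> is a multiple of the return time.\<close>

lemma equivclp_susp_shift_iff:
  assumes a: "a \<in> S" and b: "b \<in> S"
  shows "equivclp shift (a, u) (b, v) \<longleftrightarrow> \<Phi> u a = \<Phi> v b"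
proof
  have inv: "\<Phi> (snd p) (fst p) = \<Phi> (snd q) (fst q)" if "shift p q" for p q
    using that S_subset flow_add unfolding susp_shift_def by auto
  have "\<Phi> (snd p) (fst p) = \<Phi> (snd q) (fst q)" if "equivclp shift p q" for p q
    using that
    by (induction rule: equivclp_induct) (auto dest: inv)
  then show "\<Phi> u a = \<Phi> v b" if "equivclp shift (a, u) (b, v)"
    using that by fastforce
next
  assume eq: "\<Phi> u a = \<Phi> v b"
  have "\<Phi> (u - v) a = \<Phi> (- v) (\<Phi> v b)"
    using flow_add[of a "- v" u] a S_subset eq by auto
  also have "\<dots> = b" using flow_uminus b S_subset by blast
  finally have ba: "\<Phi> (u - v) a = b" .
  then obtain k :: int where k: "u - v = of_int k * c"
    using return_times[OF a] b by blast
  then have "u = v + of_int k * c" by simp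
  then show "equivclp shift (a, u) (b, v)"
    using equivclp_shift_multiple[OF a, of v k] ba k by metis
qed

lemma in_region_iff: "(x, s) \<in> region \<longleftrightarrow> x \<in> S \<and> 0 \<le> s \<and> s \<le> c"
  by (auto simp: susp_region_def)

text \<open>The inverse image of \<open>z\<close> under \<open>(x, s) \<mapsto> \<Phi> s x\<close>. It is a single class of the gluing,
  hence a point of the suspension space, and \<open>fibre\<close> itself is the conjugacy.\<close>

definition fibre :: "'z \<Rightarrow> ('z \<times> real) set" where
  "fibre z = {(x, s) \<in> region. \<Phi> s x = z}"

lemma glue_class_eq_fibre:
  assumes "(x, s) \<in> region"
  shows "Collect (equivclp glue (x, s)) = fibre (\<Phi> s x)"
proof -
  have "(y, v) \<in> region" if "equivclp glue (x, s) (y, v)" for y v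
    by (rule equivclp_susp_glue_region[OF _ _ assms that])
      (use c_pos flow_period_in_S in auto)
  moreover have "equivclp glue (x, s) (y, v) \<longleftrightarrow> \<Phi> s x = \<Phi> v y" if "(y, v) \<in> region" for y v
    using susp_shift_on_region[OF _ inj_on_return_map assms that] c_pos
      equivclp_susp_shift_iff assms that
    by (metis in_region_iff)
  ultimately show ?thesis unfolding fibre_def by (auto simp: eq_commute)
qed

lemma fibre_nonempty:
  assumes z: "z \<in> topspace Z"
  obtains x s where "(x, s) \<in> region" "\<Phi> s x = z"
proof -
  obtain t where t: "\<Phi> t z \<in> S" using meets_orbits[OF z] by blast
  \<comment> \<open>The multiple of \<open>c\<close> that moves the time \<open>- t\<close> into \<open>[0, c]\<close>.\<close>
  define k where "k = \<lfloor>- t / c\<rfloor>"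
  define s where "s = - t - of_int k * c"
  define x where "x = \<Phi> (of_int k * c) (\<Phi> t z)"
  have "of_int k \<le> - t / c" "- t / c < of_int k + 1"
    unfolding k_def by linarith+
  then have "0 \<le> s" "s \<le> c"
    unfolding s_def using c_pos by (simp_all add: field_simps)
  moreover have "x \<in> S" unfolding x_def using t by (rule flow_multiple_in_S)
  moreover have "\<Phi> s x = z"
  proof -
    have "\<Phi> s x = \<Phi> (- t) (\<Phi> t z)"
      unfolding x_def s_def using flow_add[of "\<Phi> t z" "- t - of_int k * c" "of_int k * c"]
        t S_subset by auto
    then show ?thesis using flow_uminus z by simp
  qed
  ultimately show ?thesis using that in_region_iff by blast
qed

abbreviation strip :: "('z \<times> real) topology" where
  "strip \<equiv> subtopology (prod_topology W euclideanreal) region"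

lemma topspace_strip: "topspace strip = region"
  by (auto simp: susp_region_def)

lemma quotient_map_strip: "quotient_map strip Z (\<lambda>(x, s). \<Phi> s x)"
proof (rule continuous_closed_imp_quotient_map)
  have "continuous_map (prod_topology W euclideanreal) (prod_topology euclideanreal Z)
      (\<lambda>p. (snd p, fst p))"
    by (intro continuous_map_pairedI continuous_map_snd)
      (metis continuous_map_fst continuous_map_into_fulltopology)
  from continuous_map_compose[OF this continuous_flow]
  have "continuous_map (prod_topology W euclideanreal) Z (\<lambda>(x, s). \<Phi> s x)"
    by (simp add: o_def case_prod_unfold)
  then show cont: "continuous_map strip Z (\<lambda>(x, s). \<Phi> s x)"
    by (rule continuous_map_from_subtopology)
  have "compact_space Z" using flow by (simp add: topological_flow_def)
  then have "compactin W S"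
    using closedin_compact_space[OF _ closed] by (simp add: compactin_subtopology)
  then have "compactin (prod_topology W euclideanreal) (S \<times> {0..c})"
    by (simp add: compactin_Times)
  moreover have "S \<times> {0..c} = region" by (auto simp: in_region_iff)
  ultimately have "compact_space strip"
    by (simp add: compact_space_subtopology)
  then show "closed_map strip Z (\<lambda>(x, s). \<Phi> s x)"
    using Hausdorff_imp_kc_space[OF Hausdorff] cont by (rule continuous_imp_closed_map_gen)
  show "(\<lambda>(x, s). \<Phi> s x) ` topspace strip = topspace Z"
  proof
    show "(\<lambda>(x, s). \<Phi> s x) ` topspace strip \<subseteq> topspace Z"
      using cont by (rule continuous_map_image_subset_topspace)
    show "topspace Z \<subseteq> (\<lambda>(x, s). \<Phi> s x) ` topspace strip"
      unfolding topspace_strip by (force elim: fibre_nonempty)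
  qed
qed

text \<open>Both \<open>Z\<close> and the suspension space are quotients of the strip with the same fibres, so
  \<open>fibre\<close> is a quotient map because its composition with the first quotient map is the second.\<close>

lemma homeomorphic_map_fibre: "homeomorphic_map Z (susp_space W (\<Phi> c) (\<lambda>_. c)) fibre"
  unfolding homeomorphic_map_def
proof
  have proj: "quotient_map strip (susp_space W (\<Phi> c) (\<lambda>_. c)) (\<lambda>p. Collect (equivclp glue p))"
    unfolding susp_space_def by (rule quotient_map_quotient_topology)
  have "fibre ((\<lambda>(x, s). \<Phi> s x) p) = Collect (equivclp glue p)" if "p \<in> topspace strip" for p
    using that glue_class_eq_fibre unfolding topspace_strip by (cases p) simp
  then have comp: "quotient_map strip (susp_space W (\<Phi> c) (\<lambda>_. c)) (fibre \<circ> (\<lambda>(x, s). \<Phi> s x))"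
    using proj by (auto intro: quotient_map_eq)
  then have "continuous_map Z (susp_space W (\<Phi> c) (\<lambda>_. c)) fibre"
    using continuous_compose_quotient_map[OF quotient_map_strip] quotient_imp_continuous_map
    by blast
  then show "quotient_map Z (susp_space W (\<Phi> c) (\<lambda>_. c)) fibre"
    using quotient_map_from_composition comp quotient_imp_continuous_map[OF quotient_map_strip]
    by blast
  show "inj_on fibre (topspace Z)"
  proof (rule inj_onI)
    fix y z assume "y \<in> topspace Z" and eq: "fibre y = fibre z"
    then obtain x s where "(x, s) \<in> fibre y" unfolding fibre_def by (blast elim: fibre_nonempty)
    with eq show "y = z" unfolding fibre_def by auto
  qed
qed

text \<open>Moving a pair \<open>(x, s)\<close> of \<open>fibre z\<close> to \<open>(x, s + t)\<close> may leave the strip, but the moved pair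
  represents \<open>\<Phi> t z\<close>, and by \<open>equivclp_susp_shift_iff\<close> so do precisely the pairs that the
  identifications lead to.\<close>

theorem conjugate_suspension:
  "flow_conjugate Z \<Phi> (susp_space W (\<Phi> c) (\<lambda>_. c)) (susp_flow W (\<Phi> c) (\<lambda>_. c))"
proof -
  have "fibre (\<Phi> t z) = susp_flow W (\<Phi> c) (\<lambda>_. c) t (fibre z)" if z: "z \<in> topspace Z" for t z
  proof -
    have move: "equivclp shift (x, s + t) (y, v) \<longleftrightarrow> \<Phi> v y = \<Phi> t z"
      if "(x, s) \<in> fibre z" and "(y, v) \<in> region" for x s y v
    proof -
      have x: "x \<in> S" "\<Phi> s x = z" and y: "y \<in> S"
        using that by (auto simp: fibre_def in_region_iff)
      have "\<Phi> (s + t) x = \<Phi> t z"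
        using flow_add[of x t s] x S_subset by (auto simp: add.commute)
      then show ?thesis using equivclp_susp_shift_iff x(1) y by auto
    qed
    obtain x s where xs: "(x, s) \<in> fibre z"
      using fibre_nonempty[OF z] unfolding fibre_def by blast
    have "(y, v) \<in> fibre (\<Phi> t z) \<longleftrightarrow> (y, v) \<in> susp_flow W (\<Phi> c) (\<lambda>_. c) t (fibre z)" for y v
      using move xs unfolding susp_flow_def fibre_def[of "\<Phi> t z"] by blast
    then show ?thesis by auto
  qed
  then show ?thesis
    unfolding flow_conjugate_def using homeomorphic_map_fibre by blast
qed

end


section \<open>Flows over a circle\<close>

lemma in_circle_iff:
  assumes "x \<in> topspace (circle n)" and "a \<in> x"
  shows "b \<in> x \<longleftrightarrow> (\<exists>k::int. b - a = of_int k * fact n)"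
proof -
  obtain d where x: "x = Collect (circle_rel n d)"
    using assms(1) unfolding circle_def topspace_quotient_topology by blast
  then obtain i :: int where a: "a = d + of_int i * fact n"
    using assms(2) by (auto simp: circle_rel_def)
  show ?thesis
  proof
    assume "b \<in> x"
    then obtain j :: int where "b = d + of_int j * fact n"
      using x by (auto simp: circle_rel_def)
    with a have "b - a = of_int (j - i) * fact n" by (simp add: algebra_simps)
    then show "\<exists>k::int. b - a = of_int k * fact n" by blast
  next
    assume "\<exists>k::int. b - a = of_int k * fact n"
    then obtain k :: int where "b - a = of_int k * fact n" by blast
    with a have "b = d + of_int (i + k) * fact n" by (simp add: algebra_simps)
    then show "b \<in> x" using x unfolding circle_rel_def by blast
  qed
qed

lemma circle_nonempty:
  assumes "x \<in> topspace (circle n)"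
  obtains a where "a \<in> x"
proof -
  obtain d where "x = Collect (circle_rel n d)"
    using assms unfolding circle_def topspace_quotient_topology by blast
  moreover have "circle_rel n d d" unfolding circle_rel_def by (rule exI[of _ 0]) simp
  ultimately show ?thesis using that by blast
qed

lemma closed_multiples:
  fixes c :: real
  shows "closed {of_int k * c |k::int. True}"
proof (cases "c = 0")
  case True
  then have "{of_int k * c |k::int. True} = {0}" by auto
  then show ?thesis by simp
next
  case False
  have "{of_int k * c |k::int. True} = (\<lambda>x. x * c) ` \<int>"
    by (auto simp: Ints_def)
  also have "\<dots> = (\<lambda>x. x / c) -` \<int>"
    using False by (force simp: image_iff)
  finally show ?thesis
    using closed_vimage[OF closed_Ints, of "\<lambda>x. x / c"] False
    by (simp add: continuous_intros)
qed

text \<open>The set contains only the class of \<open>0\<close>. It is closed because the circle is a quotient of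
  the real line, where its preimage is the closed set of multiples of \<open>n!\<close>.\<close>

lemma closedin_circle_zero: "closedin (circle n) {x \<in> topspace (circle n). 0 \<in> x}"
proof -
  have q: "quotient_map euclideanreal (circle n) (\<lambda>a. Collect (circle_rel n a))"
    unfolding circle_def by (rule quotient_map_quotient_topology)
  have "{a::real. 0 \<in> Collect (circle_rel n a)} = {of_int k * fact n |k::int. True}"
  proof (intro set_eqI iffI)
    fix a :: real assume "a \<in> {a. 0 \<in> Collect (circle_rel n a)}"
    then obtain k :: int where "0 = a + of_int k * fact n" by (auto simp: circle_rel_def)
    then have "a = of_int (- k) * fact n" by simp
    then show "a \<in> {of_int k * fact n |k::int. True}" by blast
  next
    fix a :: real assume "a \<in> {of_int k * fact n |k::int. True}"
    then obtain k :: int where "a = of_int k * fact n" by blast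
    then have "0 = a + of_int (- k) * fact n" by simp
    then show "a \<in> {a. 0 \<in> Collect (circle_rel n a)}" unfolding circle_rel_def by blast
  qed
  then have "closed {a::real. 0 \<in> Collect (circle_rel n a)}"
    by (simp only: closed_multiples)
  moreover have "Collect (circle_rel n a) \<in> topspace (circle n)" for a
    unfolding circle_def topspace_quotient_topology by simp
  ultimately show ?thesis
    using q unfolding quotient_map_closedin by (auto simp: Collect_conj_eq)
qed

text \<open>Along an orbit, \<open>q\<close> runs around the circle of length \<open>n!\<close> at unit speed. So it passes
  through the class of \<open>0\<close>, and comes back to it exactly after multiples of \<open>n!\<close>.\<close>

lemma constant_return_section_over_circle:
  assumes flow: "topological_flow Z \<Phi>" and Hausdorff: "Hausdorff_space Z"
    and q: "continuous_map Z (circle n) q"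
    and equivariant: "\<And>t z. z \<in> topspace Z \<Longrightarrow> q (\<Phi> t z) = (\<lambda>a. a + t) ` q z"
  shows "constant_return_section Z \<Phi> {z \<in> topspace Z. 0 \<in> q z} (fact n)"
proof
  have qz: "q z \<in> topspace (circle n)" if "z \<in> topspace Z" for z
    using q that by (auto dest: continuous_map_funspace)
  have inZ: "\<Phi> t z \<in> topspace Z" if "z \<in> topspace Z" for t z
    using flow that continuous_map_funspace[of "prod_topology euclideanreal Z" Z "\<lambda>(t, x). \<Phi> t x"]
    unfolding topological_flow_def by (auto simp: Pi_iff)
  have zero_iff: "0 \<in> q (\<Phi> t z) \<longleftrightarrow> - t \<in> q z" if "z \<in> topspace Z" for t z
  proof -
    have "0 = a + t \<longleftrightarrow> a = - t" for a by linarith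
    then show ?thesis unfolding equivariant[OF that] image_iff by simp
  qed
  show "topological_flow Z \<Phi>" "Hausdorff_space Z" by fact+
  show "(0::real) < fact n" by simp
  have "{z \<in> topspace Z. 0 \<in> q z} = {z \<in> topspace Z. q z \<in> {x \<in> topspace (circle n). 0 \<in> x}}"
    using qz by auto
  then show "closedin Z {z \<in> topspace Z. 0 \<in> q z}"
    using closedin_continuous_map_preimage[OF q closedin_circle_zero] by simp
  show "\<exists>t. \<Phi> t z \<in> {z \<in> topspace Z. 0 \<in> q z}" if z: "z \<in> topspace Z" for z
  proof -
    obtain a where "a \<in> q z" using circle_nonempty[OF qz[OF z]] .
    then have "0 \<in> q (\<Phi> (- a) z)" using zero_iff[OF z] by simp
    then show ?thesis using inZ[OF z] by blast
  qed
  show "\<Phi> t x \<in> {z \<in> topspace Z. 0 \<in> q z} \<longleftrightarrow> (\<exists>k::int. t = of_int k * fact n)"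
    if "x \<in> {z \<in> topspace Z. 0 \<in> q z}" for x t
  proof -
    have x: "x \<in> topspace Z" "0 \<in> q x" using that by auto
    have "0 \<in> q (\<Phi> t x) \<longleftrightarrow> (\<exists>k::int. - t = of_int k * fact n)"
      using zero_iff[OF x(1)] in_circle_iff[OF qz[OF x(1)] x(2), of "- t"] by simp
    also have "\<dots> \<longleftrightarrow> (\<exists>k::int. t = of_int k * fact n)"
      by (metis minus_equation_iff mult_minus_left of_int_minus)
    finally show ?thesis using inZ[OF x(1)] by simp
  qed
qed

theorem proposition1p1:
  fixes Z :: "'z topology" and \<Phi> :: "real \<Rightarrow> 'z \<Rightarrow> 'z"
  assumes "topological_flow Z \<Phi>"
    and "metrizable_space Z"
    and "flow_extension Z \<Phi> solenoid solenoid_flow"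
  shows "\<exists>(W :: 'z topology) (T :: 'z \<Rightarrow> 'z) (f :: 'z \<Rightarrow> real).
    compact_space W \<and> metrizable_space W \<and>
    homeomorphic_map W W T \<and>
    (\<forall>x\<in>topspace W. 0 < f x) \<and> f constant_on topspace W \<and>
    flow_conjugate Z \<Phi> (susp_space W T f) (susp_flow W T f)"
proof -
  obtain p where p: "continuous_map Z solenoid p"
    and equivariant: "\<And>t z. z \<in> topspace Z \<Longrightarrow> p (\<Phi> t z) = solenoid_flow t (p z)"
    using assms(3) unfolding flow_extension_def by blast
  define S where "S = {z \<in> topspace Z. 0 \<in> p z 1}"
  have "continuous_map Z (circle 1) (\<lambda>z. p z 1)"
    using p unfolding solenoid_def continuous_map_in_subtopology continuous_map_componentwise
    by simp
  moreover have "p (\<Phi> t z) 1 = (\<lambda>a. a + t) ` p z 1" if "z \<in> topspace Z" for t z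
    using equivariant[OF that] by (simp add: solenoid_flow_def)
  ultimately have "constant_return_section Z \<Phi> S (fact 1)"
    unfolding S_def
    by (intro constant_return_section_over_circle assms(1)
        metrizable_imp_Hausdorff_space[OF assms(2)])
  then interpret constant_return_section Z \<Phi> S 1 by simp
  have "compact_space (subtopology Z S)"
    using assms(1) closedin_compact_space[OF _ closed] compact_space_subtopology
    unfolding topological_flow_def by blast
  moreover have "metrizable_space (subtopology Z S)"
    using assms(2) by (rule metrizable_space_subtopology)
  ultimately show ?thesis
    using homeomorphic_return_map conjugate_suspension
    by (intro exI[of _ "subtopology Z S"] exI[of _ "\<Phi> 1"] exI[of _ "\<lambda>_. 1"])
      (auto simp: constant_on_def)
qed

end
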